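(* Let $R$ be a ring. If the left $R$-module $R^+=\mathrm{Hom}_{\mathbb{Z}}(R,\mathbb{Q}/\mathbb{Z})$ (the character module of the right $R$-module $R_R$) is Baer, then $R$ is a von Neumann regular ring.
   Context: Rings have a unit element and modules are unitary. A (left or right) module $L$ is Baer if for every non-empty subset $X$ of its endomorphism ring the submodule $\bigcap_{f\in X}\ker f$ is a direct summand of $L$. $R$ is von Neumann regular if for every $a\in R$ there is $b\in R$ with $a=aba$. *)

theory Defs
  imports "HOL-Algebra.Algebra"
begin

text \<open>The library locale \<^locale>\<open>module\<close> requires a commutative ring of scalars; this is
  the same notion over an arbitrary ring. The record type and the locale \<^locale>\<open>submodule\<close>
  are reused from the library; the multiplicative fields of the record play no role.\<close>

locale left_module = R?: ring R + M?: abelian_group M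
  for R :: "('a, 'm) ring_scheme" (structure)
    and M :: "('a, 'b, 'n) module_scheme" (structure) +
  assumes smult_closed [simp, intro]:
      "\<lbrakk>a \<in> carrier R; x \<in> carrier M\<rbrakk> \<Longrightarrow> a \<odot>\<^bsub>M\<^esub> x \<in> carrier M"
    and smult_l_distr:
      "\<lbrakk>a \<in> carrier R; b \<in> carrier R; x \<in> carrier M\<rbrakk> \<Longrightarrow>
       (a \<oplus>\<^bsub>R\<^esub> b) \<odot>\<^bsub>M\<^esub> x = a \<odot>\<^bsub>M\<^esub> x \<oplus>\<^bsub>M\<^esub> b \<odot>\<^bsub>M\<^esub> x"
    and smult_r_distr:
      "\<lbrakk>a \<in> carrier R; x \<in> carrier M; y \<in> carrier M\<rbrakk> \<Longrightarrow>
       a \<odot>\<^bsub>M\<^esub> (x \<oplus>\<^bsub>M\<^esub> y) = a \<odot>\<^bsub>M\<^esub> x \<oplus>\<^bsub>M\<^esub> a \<odot>\<^bsub>M\<^esub> y"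
    and smult_assoc1:
      "\<lbrakk>a \<in> carrier R; b \<in> carrier R; x \<in> carrier M\<rbrakk> \<Longrightarrow>
       (a \<otimes>\<^bsub>R\<^esub> b) \<odot>\<^bsub>M\<^esub> x = a \<odot>\<^bsub>M\<^esub> (b \<odot>\<^bsub>M\<^esub> x)"
    and smult_one [simp]:
      "x \<in> carrier M \<Longrightarrow> \<one>\<^bsub>R\<^esub> \<odot>\<^bsub>M\<^esub> x = x"

definition module_End :: "('a, 'm) ring_scheme \<Rightarrow> ('a, 'b, 'n) module_scheme \<Rightarrow> ('b \<Rightarrow> 'b) set"
  where "module_End R M =
    {f \<in> hom (add_monoid M) (add_monoid M) \<inter> extensional (carrier M).
       \<forall>a \<in> carrier R. \<forall>x \<in> carrier M. f (a \<odot>\<^bsub>M\<^esub> x) = a \<odot>\<^bsub>M\<^esub> f x}"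

definition direct_summand ::
  "('a, 'm) ring_scheme \<Rightarrow> ('a, 'b, 'n) module_scheme \<Rightarrow> 'b set \<Rightarrow> bool"
  where "direct_summand R M N \<longleftrightarrow>
    submodule N R M \<and>
    (\<exists>K. submodule K R M \<and> N <+>\<^bsub>M\<^esub> K = carrier M \<and> N \<inter> K = {\<zero>\<^bsub>M\<^esub>})"

locale Baer_module = left_module +
  assumes Baer:
    "\<lbrakk>F \<subseteq> module_End R M; F \<noteq> {}\<rbrakk> \<Longrightarrow> direct_summand R M (\<Inter>f\<in>F. a_kernel M M f)"

locale von_Neumann_regular_ring = ring +
  assumes regular: "a \<in> carrier R \<Longrightarrow> \<exists>b \<in> carrier R. a = a \<otimes> b \<otimes> a"

definition rat_group :: "rat monoid"
  where "rat_group = \<lparr>carrier = UNIV, monoid.mult = (+), one = 0\<rparr>"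

definition Q_mod_Z :: "rat set monoid"
  where "Q_mod_Z = rat_group Mod \<int>"

text \<open>The left action comes from right multiplication on \<open>R\<close>, that is,
  \<open>(r f)(x) = f (x r)\<close>.\<close>

definition character_module :: "('a, 'm) ring_scheme \<Rightarrow> ('a, 'a \<Rightarrow> rat set) module"
  where "character_module R =
    \<lparr>carrier = hom (add_monoid R) Q_mod_Z \<inter> extensional (carrier R),
     monoid.mult = undefined,
     one = undefined,
     ring.zero = (\<lambda>x \<in> carrier R. \<one>\<^bsub>Q_mod_Z\<^esub>),
     ring.add = (\<lambda>f g. \<lambda>x \<in> carrier R. f x \<otimes>\<^bsub>Q_mod_Z\<^esub> g x),
     smult = (\<lambda>r f. \<lambda>x \<in> carrier R. f (x \<otimes>\<^bsub>R\<^esub> r))\<rparr>"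

lemma comm_group_rat_group: "comm_group rat_group"
proof (rule comm_groupI)
  fix x assume "x \<in> carrier rat_group"
  have "- x + x = 0" by simp
  then show "\<exists>y \<in> carrier rat_group. y \<otimes>\<^bsub>rat_group\<^esub> x = \<one>\<^bsub>rat_group\<^esub>"
    unfolding rat_group_def by (intro bexI[of _ "- x"]) auto
qed (auto simp: rat_group_def)

lemma subgroup_Ints: "subgroup \<int> rat_group"
proof -
  interpret comm_group rat_group by (rule comm_group_rat_group)
  have inv: "inv\<^bsub>rat_group\<^esub> x = - x" for x
    by (rule inv_equality) (auto simp: rat_group_def)
  show ?thesis
    by unfold_locales (use inv in \<open>auto simp: rat_group_def\<close>)
qed

lemma comm_group_Q_mod_Z: "comm_group Q_mod_Z"
  unfolding Q_mod_Z_def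
  using comm_group.abelian_FactGroup[OF comm_group_rat_group subgroup_Ints] .

lemma left_module_character_module:
  assumes "ring R"
  shows "left_module R (character_module R)"
proof -
  interpret R: ring R by fact
  interpret Q: comm_group Q_mod_Z by (rule comm_group_Q_mod_Z)
  let ?M = "character_module R"
  have car: "f \<in> carrier ?M \<longleftrightarrow> (\<forall>x \<in> carrier R. f x \<in> carrier Q_mod_Z) \<and>
      (\<forall>x \<in> carrier R. \<forall>y \<in> carrier R. f (x \<oplus>\<^bsub>R\<^esub> y) = f x \<otimes>\<^bsub>Q_mod_Z\<^esub> f y) \<and>
      f \<in> extensional (carrier R)" for f
    by (auto simp: character_module_def hom_def)
  have add: "f \<oplus>\<^bsub>?M\<^esub> g = (\<lambda>x \<in> carrier R. f x \<otimes>\<^bsub>Q_mod_Z\<^esub> g x)" for f g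
    by (simp add: character_module_def)
  have zero: "\<zero>\<^bsub>?M\<^esub> = (\<lambda>x \<in> carrier R. \<one>\<^bsub>Q_mod_Z\<^esub>)"
    by (simp add: character_module_def)
  have smult: "r \<odot>\<^bsub>?M\<^esub> f = (\<lambda>x \<in> carrier R. f (x \<otimes>\<^bsub>R\<^esub> r))" for r f
    by (simp add: character_module_def)
  have ab: "abelian_group ?M"
  proof (rule abelian_groupI)
    fix f assume f: "f \<in> carrier ?M"
    show "\<exists>g \<in> carrier ?M. g \<oplus>\<^bsub>?M\<^esub> f = \<zero>\<^bsub>?M\<^esub>"
    proof
      show "(\<lambda>x \<in> carrier R. inv\<^bsub>Q_mod_Z\<^esub> f x) \<in> carrier ?M"
        using f by (auto simp: car Q.inv_mult)
      show "(\<lambda>x \<in> carrier R. inv\<^bsub>Q_mod_Z\<^esub> f x) \<oplus>\<^bsub>?M\<^esub> f = \<zero>\<^bsub>?M\<^esub>"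
        using f by (auto simp: car add zero intro!: restrict_ext)
    qed
  next
    fix f assume "f \<in> carrier ?M"
    then show "\<zero>\<^bsub>?M\<^esub> \<oplus>\<^bsub>?M\<^esub> f = f"
      by (auto simp: car add zero extensional_def fun_eq_iff)
  qed (auto simp: car add zero Q.m_ac intro!: restrict_ext)
  show ?thesis
  proof (intro left_module.intro left_module_axioms.intro)
    show "ring R" by fact
    show "abelian_group ?M" by (rule ab)
  qed (auto simp: car add smult R.l_distr R.r_distr R.m_assoc extensional_def fun_eq_iff
        intro!: restrict_ext)
qed

end

theory Submission
  imports Defs
begin

text \<open>Let \<open>N\<close> be the submodule of characters vanishing on \<open>a R\<close>. It is the kernel of the
  endomorphism \<open>f \<mapsto> f (a \<cdot> _)\<close>, so it has a complement \<open>K\<close>. If \<open>a \<notin> a R a\<close>, divisibility of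
  \<open>\<rat>/\<int>\<close> yields a character \<open>\<chi>\<close> vanishing on \<open>a R a\<close> with \<open>\<chi> a \<noteq> 0\<close>. Write \<open>\<chi> = f + k\<close> with
  \<open>f \<in> N\<close> and \<open>k \<in> K\<close>. Since \<open>a \<chi>\<close> vanishes on \<open>a R\<close>, so does \<open>a k = a \<chi> - a f\<close>; hence
  \<open>a k \<in> N \<inter> K = 0\<close> and \<open>\<chi> a = (a \<chi>) 1 = (a f) 1 = f a = 0\<close>, a contradiction.\<close>

section \<open>Extending homomorphisms into divisible groups\<close>

text \<open>\<open>d\<close> is the order of the coset of \<open>x\<close> in the quotient by
  \<open>K\<close>. An infinite order gives \<open>d = 0\<close>, and then \<open>0 dvd n\<close>
  correctly leaves only \<open>n = 0\<close>.\<close>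

lemma (in comm_group) int_pow_mem_subgroupE:
  assumes K: "subgroup K G" and x: "x \<in> carrier G"
  obtains d :: nat where "\<And>n :: int. x [^] n \<in> K \<longleftrightarrow> int d dvd n"
proof -
  interpret N: normal K G
    using K by (rule subgroup_imp_normal)
  interpret F: group "G Mod K"
    by (rule N.factorgroup_is_group)
  have c: "K #> x \<in> carrier (G Mod K)"
    using x by (auto simp: FactGroup_def RCOSETS_def)
  have "x [^] n \<in> K \<longleftrightarrow> int (F.ord (K #> x)) dvd n" for n :: int
  proof -
    have "x [^] n \<in> K \<longleftrightarrow> K #> (x [^] n) = K"
      using K x by (metis int_pow_closed coset_join1 coset_join2 subgroup.subset)
    also have "\<dots> \<longleftrightarrow> (K #> x) [^]\<^bsub>G Mod K\<^esub> n = \<one>\<^bsub>G Mod K\<^esub>"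
      using x by (simp add: N.FactGroup_int_pow)
    also have "\<dots> \<longleftrightarrow> int (F.ord (K #> x)) dvd n"
      using c by (rule F.int_pow_eq_id)
    finally show ?thesis .
  qed
  then show thesis
    by (rule that)
qed

section \<open>Partial homomorphisms as single-valued subgroups of a product\<close>

lemma int_pow_DirProd:
  assumes "group G" "group H" "x \<in> carrier G" "y \<in> carrier H"
  shows "(x, y) [^]\<^bsub>G \<times>\<times> H\<^esub> (n :: int) = (x [^]\<^bsub>G\<^esub> n, y [^]\<^bsub>H\<^esub> n)"
proof (rule prod_eqI)
  have P: "group (G \<times>\<times> H)" and xy: "(x, y) \<in> carrier (G \<times>\<times> H)"
    using assms by (auto simp: DirProd_group)
  have hom_fst: "fst \<in> hom (G \<times>\<times> H) G" and hom_snd: "snd \<in> hom (G \<times>\<times> H) H"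
    by (auto simp: hom_def)
  show "fst ((x, y) [^]\<^bsub>G \<times>\<times> H\<^esub> n) = fst (x [^]\<^bsub>G\<^esub> n, y [^]\<^bsub>H\<^esub> n)"
    using hom_int_pow[OF hom_fst xy P \<open>group G\<close>] by simp
  show "snd ((x, y) [^]\<^bsub>G \<times>\<times> H\<^esub> n) = snd (x [^]\<^bsub>G\<^esub> n, y [^]\<^bsub>H\<^esub> n)"
    using hom_int_pow[OF hom_snd xy P \<open>group H\<close>] by simp
qed

lemma comm_group_DirProd:
  assumes "comm_group G" "comm_group H"
  shows "comm_group (G \<times>\<times> H)"
proof -
  interpret G: comm_group G by fact
  interpret H: comm_group H by fact
  interpret P: group "G \<times>\<times> H"
    by (rule DirProd_group) unfold_locales
  show ?thesis
    by unfold_locales (auto simp: G.m_comm H.m_comm)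
qed

text \<open>Two values over the same \<open>x\<close> differ by a value over the identity, so only
  that fibre has to be checked. A single-valued subgroup of the product is the graph of a
  homomorphism defined on a subgroup of \<open>G\<close>; extending the homomorphism means enlarging
  the graph.\<close>

lemma single_valued_subgroup_DirProdI:
  assumes "group G" "group H" and S: "subgroup S (G \<times>\<times> H)"
    and one: "\<And>y. (\<one>\<^bsub>G\<^esub>, y) \<in> S \<Longrightarrow> y = \<one>\<^bsub>H\<^esub>"
  shows "single_valued S"
proof (rule single_valuedI)
  fix x y z assume xy: "(x, y) \<in> S" and xz: "(x, z) \<in> S"
  interpret G: group G by fact
  interpret H: group H by fact
  have c: "x \<in> carrier G" "y \<in> carrier H" "z \<in> carrier H"
    using subgroup.subset[OF S] xy xz by auto
  have "(x, y) \<otimes>\<^bsub>G \<times>\<times> H\<^esub> inv\<^bsub>G \<times>\<times> H\<^esub> (x, z) \<in> S"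
    using S xy xz by (intro subgroup.m_closed subgroup.m_inv_closed)
  then have "(\<one>\<^bsub>G\<^esub>, y \<otimes>\<^bsub>H\<^esub> inv\<^bsub>H\<^esub> z) \<in> S"
    using c by (simp add: inv_DirProd[OF assms(1,2)])
  then have "y \<otimes>\<^bsub>H\<^esub> inv\<^bsub>H\<^esub> z = \<one>\<^bsub>H\<^esub>"
    by (rule one)
  then show "y = z"
    using c by (metis H.inv_equality H.inv_inv H.inv_closed)
qed

text \<open>Multiplying the graph by the cyclic subgroup generated by \<open>(x, y)\<close>
  prescribes the value \<open>y\<close> at \<open>x\<close>. The hypothesis \<open>pow\<close> says
  that this agrees with the old values on every power of \<open>x\<close> already in the domain,
  which is exactly what keeps the graph single-valued.\<close>

lemma single_valued_subgroup_DirProd_adjoin: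
  assumes G: "comm_group G" and H: "comm_group H"
    and S: "subgroup S (G \<times>\<times> H)" and sv: "single_valued S"
    and x: "x \<in> carrier G" and y: "y \<in> carrier H"
    and pow: "\<And>n :: int. x [^]\<^bsub>G\<^esub> n \<in> Domain S \<Longrightarrow> (x [^]\<^bsub>G\<^esub> n, y [^]\<^bsub>H\<^esub> n) \<in> S"
  obtains T where "subgroup T (G \<times>\<times> H)" "single_valued T" "S \<subseteq> T" "(x, y) \<in> T"
proof
  interpret G: comm_group G by (rule G)
  interpret H: comm_group H by (rule H)
  interpret P: comm_group "G \<times>\<times> H" by (rule comm_group_DirProd[OF G H])
  let ?C = "generate (G \<times>\<times> H) {(x, y)}"
  let ?T = "S <#>\<^bsub>G \<times>\<times> H\<^esub> ?C"
  have C: "?C = {(x [^]\<^bsub>G\<^esub> n, y [^]\<^bsub>H\<^esub> n) | n :: int. True}"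
    using x y by (subst P.generate_pow) (auto simp: int_pow_DirProd)
  have oneC: "\<one>\<^bsub>G \<times>\<times> H\<^esub> \<in> ?C"
    by (rule generate.one)
  have xyC: "(x, y) \<in> ?C"
    by (rule generate.incl) simp
  note Scar = subgroup.subset[OF S, THEN subsetD]
  show T: "subgroup ?T (G \<times>\<times> H)"
    using x y by (intro P.mult_subgroups S P.generate_is_subgroup) auto
  show "S \<subseteq> ?T"
  proof
    fix s assume s: "s \<in> S"
    then have "s \<otimes>\<^bsub>G \<times>\<times> H\<^esub> \<one>\<^bsub>G \<times>\<times> H\<^esub> \<in> ?T"
      using oneC unfolding set_mult_def by blast
    then show "s \<in> ?T"
      using P.r_one[OF Scar[OF s]] by simp
  qed
  show "(x, y) \<in> ?T"
  proof -
    have "\<one>\<^bsub>G \<times>\<times> H\<^esub> \<otimes>\<^bsub>G \<times>\<times> H\<^esub> (x, y) \<in> ?T"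
      using xyC subgroup.one_closed[OF S] unfolding set_mult_def by blast
    then show ?thesis
      using x y by simp
  qed
  show "single_valued ?T"
  proof (rule single_valued_subgroup_DirProdI[OF G.is_group H.is_group T])
    fix w assume "(\<one>\<^bsub>G\<^esub>, w) \<in> ?T"
    then obtain g h and n :: int where gh: "(g, h) \<in> S"
      and g: "\<one>\<^bsub>G\<^esub> = g \<otimes>\<^bsub>G\<^esub> x [^]\<^bsub>G\<^esub> n" and w: "w = h \<otimes>\<^bsub>H\<^esub> y [^]\<^bsub>H\<^esub> n"
      unfolding C set_mult_def by auto
    have c: "g \<in> carrier G" "h \<in> carrier H"
      using Scar[OF gh] by auto
    have "inv\<^bsub>G \<times>\<times> H\<^esub> (g, h) \<in> S"
      using S gh by (rule subgroup.m_inv_closed)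
    then have inv: "(inv\<^bsub>G\<^esub> g, inv\<^bsub>H\<^esub> h) \<in> S"
      using c by (simp add: inv_DirProd[OF G.is_group H.is_group])
    \<comment> \<open>A product lying over the identity forces this power of \<open>x\<close> into
      the domain of \<open>S\<close>. There \<open>pow\<close> and single-valuedness of
      \<open>S\<close> determine the second coordinate, so that it cancels \<open>h\<close>.\<close>
    have "x [^]\<^bsub>G\<^esub> n = inv\<^bsub>G\<^esub> g"
      using g c x by (metis G.int_pow_closed G.inv_equality G.m_comm)
    with inv pow[of n] have "(inv\<^bsub>G\<^esub> g, y [^]\<^bsub>H\<^esub> n) \<in> S"
      by (metis Domain.DomainI)
    with inv sv have "y [^]\<^bsub>H\<^esub> n = inv\<^bsub>H\<^esub> h"
      by (blast dest: single_valuedD)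
    then show "w = \<one>\<^bsub>H\<^esub>"
      using w c by simp
  qed
qed

lemma subgroup_Domain_DirProd:
  assumes "group G" "group H" and S: "subgroup S (G \<times>\<times> H)"
  shows "subgroup (Domain S) G"
proof -
  interpret h: group_hom "G \<times>\<times> H" G fst
    using assms by (auto simp: group_hom_def group_hom_axioms_def DirProd_group hom_def)
  show ?thesis
    using h.subgroup_img_is_subgroup[OF S] by (simp add: fst_eq_Domain)
qed

text \<open>The exponents that bring \<open>x\<close> into the domain are the multiples of one
  \<open>d\<close>, so a value \<open>y\<close> at \<open>x\<close> is compatible as soon as its
  \<open>d\<close>-th power is the value \<open>h\<close> already prescribed at the
  \<open>d\<close>-th power of \<open>x\<close>. Divisibility supplies such a
  \<open>y\<close>.\<close>

lemma single_valued_subgroup_DirProd_adjoin_divisible: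
  assumes G: "comm_group G" and H: "comm_group H"
    and div: "\<And>h (n :: nat). h \<in> carrier H \<Longrightarrow> n > 0 \<Longrightarrow> \<exists>y \<in> carrier H. y [^]\<^bsub>H\<^esub> n = h"
    and S: "subgroup S (G \<times>\<times> H)" and sv: "single_valued S" and x: "x \<in> carrier G"
  obtains T where "subgroup T (G \<times>\<times> H)" "single_valued T" "S \<subseteq> T" "x \<in> Domain T"
proof -
  interpret G: comm_group G by (rule G)
  interpret H: comm_group H by (rule H)
  interpret P: comm_group "G \<times>\<times> H" by (rule comm_group_DirProd[OF G H])
  have D: "subgroup (Domain S) G"
    using subgroup_Domain_DirProd[OF G.is_group H.is_group S] .
  obtain d :: nat where d: "\<And>n :: int. x [^]\<^bsub>G\<^esub> n \<in> Domain S \<longleftrightarrow> int d dvd n"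
    using G.int_pow_mem_subgroupE[OF D x] by blast
  obtain h where h: "(x [^]\<^bsub>G\<^esub> int d, h) \<in> S"
    using d[of "int d"] by auto
  have hc: "h \<in> carrier H"
    using subgroup.subset[OF S] h by auto
  have "\<exists>y \<in> carrier H. y [^]\<^bsub>H\<^esub> d = h"
  \<comment> \<open>Divisibility covers positive exponents only. For \<open>d = 0\<close> the
    prescribed value sits over the identity and is therefore trivial, so there is no constraint on
    \<open>y\<close>.\<close>
  proof (cases "d = 0")
    case True
    have "h = \<one>\<^bsub>H\<^esub>"
      using h True subgroup.one_closed[OF S] sv by (auto dest: single_valuedD)
    then show ?thesis
      using True by auto
  next
    case False
    then show ?thesis
      using div hc by blast
  qed
  then obtain y where y: "y \<in> carrier H" "y [^]\<^bsub>H\<^esub> d = h" ..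
  have "(x [^]\<^bsub>G\<^esub> n, y [^]\<^bsub>H\<^esub> n) \<in> S" if n: "x [^]\<^bsub>G\<^esub> n \<in> Domain S" for n :: int
  proof -
    obtain k where k: "n = int d * k"
      using n d by blast
    have "((x [^]\<^bsub>G\<^esub> int d, y [^]\<^bsub>H\<^esub> int d) [^]\<^bsub>G \<times>\<times> H\<^esub> k) \<in> S"
      using h y by (intro P.subgroup_int_pow_closed[OF S]) (simp add: int_pow_int)
    then show ?thesis
      using x y by (simp add: int_pow_DirProd k G.int_pow_pow H.int_pow_pow)
  qed
  then show thesis
    using single_valued_subgroup_DirProd_adjoin[OF G H S sv x y(1)] that by blast
qed

section \<open>Extension to the whole group by Zorn's lemma\<close>

lemma subgroup_Union_chain:
  assumes "group G" and ne: "C \<noteq> {}" and sub: "\<And>K. K \<in> C \<Longrightarrow> subgroup K G"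
    and chain: "\<And>K L. K \<in> C \<Longrightarrow> L \<in> C \<Longrightarrow> K \<subseteq> L \<or> L \<subseteq> K"
  shows "subgroup (\<Union>C) G"
proof -
  interpret group G by fact
  show ?thesis
  proof (rule subgroupI)
    fix x y assume "x \<in> \<Union>C" "y \<in> \<Union>C"
    then obtain K where "K \<in> C" "x \<in> K" "y \<in> K"
      using chain by blast
    then show "x \<otimes>\<^bsub>G\<^esub> y \<in> \<Union>C"
      using subgroup.m_closed[OF sub] by blast
  next
    fix x assume "x \<in> \<Union>C"
    then show "inv\<^bsub>G\<^esub> x \<in> \<Union>C"
      using subgroup.m_inv_closed[OF sub] by blast
  next
    show "\<Union>C \<subseteq> carrier G"
      using subgroup.subset[OF sub] by blast
    show "\<Union>C \<noteq> {}"
      using ne subgroup.one_closed[OF sub] by blast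
  qed
qed

lemma single_valued_Union_chain:
  assumes "\<And>S. S \<in> C \<Longrightarrow> single_valued S"
    and "\<And>S T. S \<in> C \<Longrightarrow> T \<in> C \<Longrightarrow> S \<subseteq> T \<or> T \<subseteq> S"
  shows "single_valued (\<Union>C)"
  using assms unfolding single_valued_def by (meson UnionE subsetD)

text \<open>This is injectivity of divisible abelian groups. For graphs, extension is inclusion and
  a chain is bounded by its union, so Zorn's lemma yields a maximal graph \<open>T\<close>; the
  one-element extension shows that its domain is all of \<open>G\<close>.\<close>

lemma hom_extending_single_valued_subgroup:
  assumes G: "comm_group G" and H: "comm_group H"
    and div: "\<And>h (n :: nat). h \<in> carrier H \<Longrightarrow> n > 0 \<Longrightarrow> \<exists>y \<in> carrier H. y [^]\<^bsub>H\<^esub> n = h"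
    and S: "subgroup S (G \<times>\<times> H)" and sv: "single_valued S"
  obtains \<chi> where "\<chi> \<in> hom G H" "\<And>x y. (x, y) \<in> S \<Longrightarrow> \<chi> x = y"
proof -
  interpret G: comm_group G by (rule G)
  interpret H: comm_group H by (rule H)
  interpret P: comm_group "G \<times>\<times> H" by (rule comm_group_DirProd[OF G H])
  let ?A = "{T. subgroup T (G \<times>\<times> H) \<and> single_valued T \<and> S \<subseteq> T}"
  have "\<exists>T \<in> ?A. \<forall>U \<in> ?A. T \<subseteq> U \<longrightarrow> U = T"
  proof (rule subset_Zorn_nonempty)
    show "?A \<noteq> {}"
      using S sv by blast
    fix C assume ne: "C \<noteq> {}" and "subset.chain ?A C"
    then have A: "C \<subseteq> ?A" and ch: "\<And>K L. K \<in> C \<Longrightarrow> L \<in> C \<Longrightarrow> K \<subseteq> L \<or> L \<subseteq> K"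
      by (auto simp: subset_chain_def)
    have "subgroup (\<Union>C) (G \<times>\<times> H)"
      using A ch by (intro subgroup_Union_chain[OF P.is_group ne]) auto
    moreover have "single_valued (\<Union>C)"
      using A ch by (intro single_valued_Union_chain) auto
    ultimately show "\<Union>C \<in> ?A"
      using A ne by blast
  qed
  then obtain T where T: "subgroup T (G \<times>\<times> H)" "single_valued T" "S \<subseteq> T"
    and max: "\<And>U. subgroup U (G \<times>\<times> H) \<Longrightarrow> single_valued U \<Longrightarrow> T \<subseteq> U \<Longrightarrow> U = T"
    by (metis (mono_tags, lifting) mem_Collect_eq order_trans)
  have total: "\<exists>y. (x, y) \<in> T" if "x \<in> carrier G" for x
    using single_valued_subgroup_DirProd_adjoin_divisible[OF G H div T(1,2) that] max
    by (metis DomainE)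
  \<comment> \<open>The description is meaningful on \<open>carrier G\<close>, where
    \<open>T\<close> is total and single-valued. Values elsewhere are unspecified, which
    \<open>hom\<close> permits.\<close>
  define \<chi> where "\<chi> x = (THE y. (x, y) \<in> T)" for x
  have eq: "\<chi> x = y" if "(x, y) \<in> T" for x y
    unfolding \<chi>_def using that T(2) by (auto dest: single_valuedD)
  have graph: "(x, \<chi> x) \<in> T" if "x \<in> carrier G" for x
    using total[OF that] eq by auto
  show thesis
  proof
    show "\<chi> \<in> hom G H"
    proof (rule homI)
      fix x assume "x \<in> carrier G"
      then show "\<chi> x \<in> carrier H"
        using graph subgroup.subset[OF T(1)] by auto
    next
      fix x y assume "x \<in> carrier G" "y \<in> carrier G"
      then have "(x, \<chi> x) \<otimes>\<^bsub>G \<times>\<times> H\<^esub> (y, \<chi> y) \<in> T"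
        by (intro subgroup.m_closed[OF T(1)] graph)
      then show "\<chi> (x \<otimes>\<^bsub>G\<^esub> y) = \<chi> x \<otimes>\<^bsub>H\<^esub> \<chi> y"
        by (simp add: eq)
    qed
    show "\<chi> x = y" if "(x, y) \<in> S" for x y
      using that T(3) eq by blast
  qed
qed

section \<open>Characters\<close>

lemma carrier_Q_mod_Z: "carrier Q_mod_Z = range (\<lambda>q. \<int> #>\<^bsub>rat_group\<^esub> q)"
  by (auto simp: Q_mod_Z_def FactGroup_def RCOSETS_def rat_group_def)

lemma nat_pow_rat_group: "q [^]\<^bsub>rat_group\<^esub> (n :: nat) = of_nat n * q"
  by (induction n) (auto simp: rat_group_def nat_pow_def algebra_simps)

lemma nat_pow_Q_mod_Z:
  "(\<int> #>\<^bsub>rat_group\<^esub> q) [^]\<^bsub>Q_mod_Z\<^esub> (n :: nat) = \<int> #>\<^bsub>rat_group\<^esub> (of_nat n * q)"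
proof -
  interpret comm_group rat_group by (rule comm_group_rat_group)
  interpret normal \<int> rat_group
    by (rule subgroup_imp_normal[OF subgroup_Ints])
  have "q \<in> carrier rat_group"
    by (simp add: rat_group_def)
  then show ?thesis
    by (simp add: Q_mod_Z_def FactGroup_pow nat_pow_rat_group)
qed

lemma divisible_Q_mod_Z:
  assumes "h \<in> carrier Q_mod_Z" "n > 0"
  shows "\<exists>y \<in> carrier Q_mod_Z. y [^]\<^bsub>Q_mod_Z\<^esub> (n :: nat) = h"
proof -
  obtain q where "h = \<int> #>\<^bsub>rat_group\<^esub> q"
    using assms by (auto simp: carrier_Q_mod_Z)
  then have "(\<int> #>\<^bsub>rat_group\<^esub> (q / of_nat n)) [^]\<^bsub>Q_mod_Z\<^esub> n = h"
    using assms by (simp add: nat_pow_Q_mod_Z)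
  then show ?thesis
    by (auto simp: carrier_Q_mod_Z)
qed

lemma coset_Ints_eq_one_iff: "\<int> #>\<^bsub>rat_group\<^esub> q = \<one>\<^bsub>Q_mod_Z\<^esub> \<longleftrightarrow> q \<in> \<int>"
proof -
  interpret comm_group rat_group by (rule comm_group_rat_group)
  have "q \<in> carrier rat_group"
    by (simp add: rat_group_def)
  then show ?thesis
    using coset_join1[OF _ _ subgroup_Ints, of q] coset_join2[OF _ subgroup_Ints, of q]
      subgroup.subset[OF subgroup_Ints]
    by (auto simp: Q_mod_Z_def FactGroup_def)
qed

text \<open>The trivial homomorphism on \<open>K\<close> is first extended to \<open>x\<close> with
  a nontrivial value, and then to all of \<open>G\<close> by divisibility.\<close>

lemma separating_character:
  assumes G: "comm_group G" and K: "subgroup K G" and x: "x \<in> carrier G" "x \<notin> K"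
  obtains \<chi> where "\<chi> \<in> hom G Q_mod_Z" "\<And>y. y \<in> K \<Longrightarrow> \<chi> y = \<one>\<^bsub>Q_mod_Z\<^esub>"
    "\<chi> x \<noteq> \<one>\<^bsub>Q_mod_Z\<^esub>"
proof -
  interpret G: comm_group G by (rule G)
  interpret Q: comm_group Q_mod_Z by (rule comm_group_Q_mod_Z)
  let ?S = "K \<times> {\<one>\<^bsub>Q_mod_Z\<^esub>}"
  have S: "subgroup ?S (G \<times>\<times> Q_mod_Z)"
    using DirProd_subgroups[OF G.is_group K Q.is_group Q.triv_subgroup] .
  have sv: "single_valued ?S"
    by (auto intro: single_valuedI)
  obtain d :: nat where d: "\<And>n :: int. x [^]\<^bsub>G\<^esub> n \<in> K \<longleftrightarrow> int d dvd n"
    using G.int_pow_mem_subgroupE[OF K x(1)] by blast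
  have "d \<noteq> 1"
    using d[of 1] x by auto
  \<comment> \<open>The class of \<open>q\<close> must be nontrivial with trivial
    \<open>d\<close>-th power. If \<open>d\<close> is positive, then \<open>1 / d\<close> works
    because \<open>d\<close> is not 1. If \<open>d = 0\<close>, no power of \<open>x\<close> with
    nonzero exponent lies in \<open>K\<close>, so any nontrivial class will do.\<close>
  define q :: rat where "q = (if d = 0 then 1 / 2 else 1 / of_nat d)"
  let ?q = "\<int> #>\<^bsub>rat_group\<^esub> q"
  have q: "?q \<in> carrier Q_mod_Z"
    by (simp add: carrier_Q_mod_Z)
  have "q \<notin> \<int>"
  proof
    assume "q \<in> \<int>"
    then obtain m :: int where m: "q = of_int m"
      by (auto elim: Ints_cases)
    have "0 < q" "q < 1"
      using \<open>d \<noteq> 1\<close> by (auto simp: q_def)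
    with m show False
      by simp
  qed
  then have q1: "?q \<noteq> \<one>\<^bsub>Q_mod_Z\<^esub>"
    by (simp add: coset_Ints_eq_one_iff)
  have qd: "?q [^]\<^bsub>Q_mod_Z\<^esub> d = \<one>\<^bsub>Q_mod_Z\<^esub>"
    by (simp add: nat_pow_Q_mod_Z coset_Ints_eq_one_iff q_def)
  have pow: "(x [^]\<^bsub>G\<^esub> n, ?q [^]\<^bsub>Q_mod_Z\<^esub> n) \<in> ?S" if "x [^]\<^bsub>G\<^esub> n \<in> Domain ?S" for n :: int
  proof -
    have xn: "x [^]\<^bsub>G\<^esub> n \<in> K"
      using that by auto
    then obtain k where "n = int d * k"
      using d by blast
    then have "?q [^]\<^bsub>Q_mod_Z\<^esub> n = (?q [^]\<^bsub>Q_mod_Z\<^esub> int d) [^]\<^bsub>Q_mod_Z\<^esub> k"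
      using q by (simp add: Q.int_pow_pow)
    then show ?thesis
      using qd xn by (simp add: int_pow_int)
  qed
  obtain T where T: "subgroup T (G \<times>\<times> Q_mod_Z)" "single_valued T" "?S \<subseteq> T" "(x, ?q) \<in> T"
    using single_valued_subgroup_DirProd_adjoin[OF G comm_group_Q_mod_Z S sv x(1) q pow] by blast
  obtain \<chi> where "\<chi> \<in> hom G Q_mod_Z" "\<And>x y. (x, y) \<in> T \<Longrightarrow> \<chi> x = y"
    using hom_extending_single_valued_subgroup[OF G comm_group_Q_mod_Z divisible_Q_mod_Z T(1,2)]
    by blast
  then show thesis
    using that T(3,4) q1 by blast
qed

section \<open>The character module and its endomorphisms\<close>

lemma carrier_character_module:
  "carrier (character_module R) = hom (add_monoid R) Q_mod_Z \<inter> extensional (carrier R)"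
  by (simp add: character_module_def)

lemma zero_character_module:
  "\<zero>\<^bsub>character_module R\<^esub> = (\<lambda>x \<in> carrier R. \<one>\<^bsub>Q_mod_Z\<^esub>)"
  by (simp add: character_module_def)

lemma add_character_module:
  "f \<oplus>\<^bsub>character_module R\<^esub> g = (\<lambda>x \<in> carrier R. f x \<otimes>\<^bsub>Q_mod_Z\<^esub> g x)"
  by (simp add: character_module_def)

lemma smult_character_module:
  "r \<odot>\<^bsub>character_module R\<^esub> f = (\<lambda>x \<in> carrier R. f (x \<otimes>\<^bsub>R\<^esub> r))"
  by (simp add: character_module_def)

lemmas character_module_simps =
  carrier_character_module zero_character_module add_character_module smult_character_module

text \<open>Scalars act through right multiplication on the argument, which commutes with left
  multiplication by \<open>a\<close> because \<open>R\<close> is associative. The outer restriction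
  makes the endomorphism extensional, the inner one makes its values extensional.\<close>

lemma left_mult_in_module_End_character_module:
  assumes "ring R" and a: "a \<in> carrier R"
  shows "(\<lambda>f \<in> carrier (character_module R). \<lambda>x \<in> carrier R. f (a \<otimes>\<^bsub>R\<^esub> x))
    \<in> module_End R (character_module R)"
proof -
  interpret ring R by fact
  interpret M: left_module R "character_module R"
    using \<open>ring R\<close> by (rule left_module_character_module)
  have c: "(\<lambda>x \<in> carrier R. f (a \<otimes>\<^bsub>R\<^esub> x)) \<in> carrier (character_module R)"
    if "f \<in> carrier (character_module R)" for f
    using that a by (auto simp: carrier_character_module hom_def r_distr)
  show ?thesis
    unfolding module_End_def
  proof (intro CollectI conjI IntI ballI)
    show "(\<lambda>f \<in> carrier (character_module R). \<lambda>x \<in> carrier R. f (a \<otimes>\<^bsub>R\<^esub> x))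
        \<in> hom (add_monoid (character_module R)) (add_monoid (character_module R))"
      using c a by (auto intro!: homI) (simp add: add_character_module cong: restrict_cong)
    fix r f assume r: "r \<in> carrier R" and f: "f \<in> carrier (character_module R)"
    have "r \<odot>\<^bsub>character_module R\<^esub> f \<in> carrier (character_module R)"
      using r f by (rule M.smult_closed)
    then show "(\<lambda>f \<in> carrier (character_module R). \<lambda>x \<in> carrier R. f (a \<otimes>\<^bsub>R\<^esub> x))
        (r \<odot>\<^bsub>character_module R\<^esub> f) = r \<odot>\<^bsub>character_module R\<^esub>
        (\<lambda>f \<in> carrier (character_module R). \<lambda>x \<in> carrier R. f (a \<otimes>\<^bsub>R\<^esub> x)) f"
      using r f a by (auto simp: smult_character_module m_assoc cong: restrict_cong)
  qed auto
qed

lemma a_kernel_left_mult_character_module: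
  "a_kernel (character_module R) (character_module R)
      (\<lambda>f \<in> carrier (character_module R). \<lambda>x \<in> carrier R. f (a \<otimes>\<^bsub>R\<^esub> x)) =
    {f \<in> carrier (character_module R). \<forall>x \<in> carrier R. f (a \<otimes>\<^bsub>R\<^esub> x) = \<one>\<^bsub>Q_mod_Z\<^esub>}"
  by (auto simp: a_kernel_def' zero_character_module fun_eq_iff restrict_def)

text \<open>By the two distributive laws the set is the image of an additive endomorphism. It serves
  as the subgroup from which \<open>a\<close> is separated.\<close>

lemma (in ring) additive_subgroup_left_right_multiples:
  assumes a: "a \<in> carrier R"
  shows "subgroup ((\<lambda>x. a \<otimes> x \<otimes> a) ` carrier R) (add_monoid R)"
proof -
  interpret h: group_hom "add_monoid R" "add_monoid R" "\<lambda>x. a \<otimes> x \<otimes> a"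
    using a by unfold_locales (auto simp: hom_def r_distr l_distr)
  show ?thesis
    using h.img_is_subgroup by simp
qed

section \<open>Regularity from the Baer condition\<close>

theorem corollary4p4:
  fixes R :: "('a, 'm) ring_scheme"
  assumes "ring R"
    and "Baer_module R (character_module R)"
  shows "von_Neumann_regular_ring R"
proof -
  interpret ring R by fact
  interpret Q: comm_group Q_mod_Z by (rule comm_group_Q_mod_Z)
  let ?M = "character_module R"
  interpret M: Baer_module R ?M by fact
  have "\<exists>b \<in> carrier R. a = a \<otimes>\<^bsub>R\<^esub> b \<otimes>\<^bsub>R\<^esub> a" if a: "a \<in> carrier R" for a
  proof (rule ccontr)
    assume no: "\<not> ?thesis"
    let ?N = "{f \<in> carrier ?M. \<forall>x \<in> carrier R. f (a \<otimes>\<^bsub>R\<^esub> x) = \<one>\<^bsub>Q_mod_Z\<^esub>}"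
    \<comment> \<open>The Baer condition is applied to the singleton of the endomorphism induced by
      left multiplication by \<open>a\<close>, so the intersection is a single kernel.\<close>
    have "direct_summand R ?M ?N"
      using M.Baer[of "{_}", OF _ insert_not_empty] left_mult_in_module_End_character_module[OF \<open>ring R\<close> a]
      by (simp flip: a_kernel_left_mult_character_module)
    then obtain K where K: "submodule K R ?M" "?N <+>\<^bsub>?M\<^esub> K = carrier ?M" "?N \<inter> K = {\<zero>\<^bsub>?M\<^esub>}"
      unfolding direct_summand_def by blast
    have "a \<notin> (\<lambda>x. a \<otimes>\<^bsub>R\<^esub> x \<otimes>\<^bsub>R\<^esub> a) ` carrier R"
      using no by blast
    then obtain \<psi> where \<psi>: "\<psi> \<in> hom (add_monoid R) Q_mod_Z" "\<psi> a \<noteq> \<one>\<^bsub>Q_mod_Z\<^esub>"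
      "\<And>x. x \<in> carrier R \<Longrightarrow> \<psi> (a \<otimes>\<^bsub>R\<^esub> x \<otimes>\<^bsub>R\<^esub> a) = \<one>\<^bsub>Q_mod_Z\<^esub>"
      using separating_character[OF a_comm_group additive_subgroup_left_right_multiples[OF a], of a] a
      by (metis (no_types, lifting) imageI partial_object.select_convs(1))
    \<comment> \<open>The separating homomorphism is arbitrary off \<open>carrier R\<close>, whereas
      elements of the character module are extensional.\<close>
    define \<chi> where "\<chi> = restrict \<psi> (carrier R)"
    have "\<chi> \<in> carrier ?M"
      using \<psi>(1) by (auto simp: \<chi>_def carrier_character_module hom_def)
    then have "\<chi> \<in> ?N <+>\<^bsub>?M\<^esub> K"
      using K(2) by blast
    then obtain f k where f: "f \<in> ?N" and k: "k \<in> K" and \<chi>: "\<chi> = f \<oplus>\<^bsub>?M\<^esub> k"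
      unfolding set_add_def' by blast
    have kc: "k \<in> carrier ?M"
      using k K(1) by (metis submodule.axioms(1) subgroup.mem_carrier partial_object.select_convs(1))
    have val: "\<psi> x = f x \<otimes>\<^bsub>Q_mod_Z\<^esub> k x" if "x \<in> carrier R" for x
      using fun_cong[OF \<chi>, of x] that by (simp add: \<chi>_def add_character_module)
    have kQ: "k x \<in> carrier Q_mod_Z" if "x \<in> carrier R" for x
      using kc that by (auto simp: carrier_character_module hom_def)
    \<comment> \<open>Reassociated, the argument is a right multiple of \<open>a\<close>, where
      \<open>f\<close> is trivial; there \<open>k\<close> agrees with \<psi>, which is trivial as
      well. The value at this argument is also the value of \<open>a\<close> times \<open>k\<close>
      at \<open>a\<close> times \<open>x\<close>, which gives membership in
      \<open>?N\<close>.\<close>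
    have "k (a \<otimes>\<^bsub>R\<^esub> x \<otimes>\<^bsub>R\<^esub> a) = \<one>\<^bsub>Q_mod_Z\<^esub>" if x: "x \<in> carrier R" for x
    proof -
      have "f (a \<otimes>\<^bsub>R\<^esub> (x \<otimes>\<^bsub>R\<^esub> a)) = \<one>\<^bsub>Q_mod_Z\<^esub>"
        using f x a by blast
      then show ?thesis
        using val[of "a \<otimes>\<^bsub>R\<^esub> x \<otimes>\<^bsub>R\<^esub> a"] \<psi>(3)[OF x] kQ[of "a \<otimes>\<^bsub>R\<^esub> x \<otimes>\<^bsub>R\<^esub> a"] x a
        by (simp add: m_assoc)
    qed
    then have "a \<odot>\<^bsub>?M\<^esub> k \<in> ?N"
      using a kc M.smult_closed[OF a kc] by (simp add: smult_character_module)
    moreover have "a \<odot>\<^bsub>?M\<^esub> k \<in> K"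
      using K(1) a k by (rule submodule.smult_closed)
    ultimately have "a \<odot>\<^bsub>?M\<^esub> k = \<zero>\<^bsub>?M\<^esub>"
      using K(3) by blast
    \<comment> \<open>Evaluation at the unit of \<open>R\<close> turns the scalar multiple of
      \<open>k\<close> by \<open>a\<close> into the value of \<open>k\<close> at
      \<open>a\<close>.\<close>
    then have "k a = \<one>\<^bsub>Q_mod_Z\<^esub>"
      using a by (auto simp: character_module_simps dest!: fun_cong[of _ _ "\<one>\<^bsub>R\<^esub>"])
    moreover have "f a = \<one>\<^bsub>Q_mod_Z\<^esub>"
      using f a by (metis (mono_tags, lifting) mem_Collect_eq one_closed r_one)
    ultimately show False
      using val[OF a] \<psi>(2) by simp
  qed
  then show ?thesis
    by unfold_locales
qed

end
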